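(* Let $s\geq 1$ be an integer and let $\Gamma\in\mathrm{LDT}(s)$ relative to $G$. Then every $G$-normal quotient of $\Gamma$ also lies in $\mathrm{LDT}(s)$ relative to a quotient group of $G$.
   Context: All graphs are finite, simple and undirected, with vertex set $V\Gamma$ and edge set $E\Gamma$. For a connected graph $\Gamma$, $d_\Gamma$ is the usual path distance, $\mathrm{diam}(\Gamma)$ its maximum value, and $\Gamma_i(v)=\{w\in V\Gamma : d_\Gamma(v,w)=i\}$. For $G\le \mathrm{Aut}(\Gamma)$, $G_v$ is the stabiliser of the vertex $v$ in $G$. A graph $\Gamma$ is locally $(G,s)$-distance transitive, where $G\le\mathrm{Aut}(\Gamma)$, if $s\le \mathrm{diam}(\Gamma)$ and for each vertex $v$ the group $G_v$ acts transitively on $\Gamma_i(v)$ for all $1\le i\le s$ (a vacuous condition when $s=0$ or $\Gamma_i(v)=\emptyset$). For $s\ge1$, $\mathrm{LDT}(s)$ is the set of connected graphs $\Gamma$ that are locally $(G,s')$-distance transitive for some $G\le\mathrm{Aut}(\Gamma)$, where $s'=\min\{s,\mathrm{diam}(\Gamma)\}$; for such $\Gamma$ and $G$ we say $\Gamma\in\mathrm{LDT}(s)$ relative to $G$. For a normal subgroup $N$ of $G$, the $G$-normal quotient $\Gamma_N$ is the graph whose vertices are the $N$-orbits on $V\Gamma$, two distinct orbits $B_1,B_2$ being adjacent iff there are $v\in B_1$, $w\in B_2$ with $\{v,w\}\in E\Gamma$. The group $G$ permutes the $N$-orbits and induces a group of automorphisms of $\Gamma_N$ isomorphic to a quotient of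 $G$; "relative to a quotient group of $G$" refers to such a quotient acting faithfully on $V\Gamma_N$. *)

theory Defs
  imports "Graph_Theory.Graph_Theory" "HOL-Algebra.Group_Action"
begin

text \<open>
  A finite simple undirected graph is a \<open>pair_graph\<close>: a finite vertex set \<open>pverts \<Gamma>\<close> with a
  symmetric irreflexive relation \<open>parcs \<Gamma>\<close>, an edge \<open>{u, v}\<close> being the two pairs
  \<open>(u, v)\<close> and \<open>(v, u)\<close>.
\<close>

subsection \<open>Distance\<close>

text \<open>Only meaningful when some walk joins \<open>u\<close> to \<open>v\<close>; below it is used on connected graphs only.\<close>

definition gdist :: "'a pair_pre_digraph \<Rightarrow> 'a \<Rightarrow> 'a \<Rightarrow> nat" where
  "gdist \<Gamma> u v = (LEAST n. \<exists>p. pre_digraph.awalk (with_proj \<Gamma>) u p v \<and> length p = n)"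

text \<open>Agreement with the shortest-path distance of the library for unit arc weights.\<close>

lemma gdist_eq_mu:
  assumes "wf_digraph (with_proj \<Gamma>)" and "u \<rightarrow>\<^sup>*\<^bsub>with_proj \<Gamma>\<^esub> v"
  shows "wf_digraph.\<mu> (with_proj \<Gamma>) (\<lambda>_. 1) u v = ereal (real (gdist \<Gamma> u v))"
proof -
  interpret wf_digraph "with_proj \<Gamma>" by fact
  have cost: "awalk_cost (\<lambda>_. 1) p = real (length p)" for p :: "('a \<times> 'a) list"
    by (induction p) auto
  obtain p where "awalk u p v" using assms(2) by (auto simp: reachable_awalk)
  then have "\<exists>n p. awalk u p v \<and> length p = n" by blast
  then have "\<exists>p. awalk u p v \<and> length p = gdist \<Gamma> u v"
    unfolding gdist_def by (rule LeastI_ex)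
  moreover have "gdist \<Gamma> u v \<le> length q" if "awalk u q v" for q
    unfolding gdist_def using that by (blast intro: Least_le)
  ultimately show ?thesis
    unfolding \<mu>_def by (intro antisym INF_greatest) (auto simp: cost intro: INF_lower2)
qed

definition diam :: "'a pair_pre_digraph \<Rightarrow> nat" where
  "diam \<Gamma> = Max {gdist \<Gamma> u v | u v. u \<in> pverts \<Gamma> \<and> v \<in> pverts \<Gamma>}"

definition sphere_at :: "'a pair_pre_digraph \<Rightarrow> nat \<Rightarrow> 'a \<Rightarrow> 'a set" where
  "sphere_at \<Gamma> i v = {w \<in> pverts \<Gamma>. gdist \<Gamma> v w = i}"

subsection \<open>Groups of automorphisms\<close>

text \<open>
  As in \<open>BijGroup\<close>, permutations of the vertex set are extensional functions, so that distinct
  elements of the group act differently.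
\<close>

definition graph_auts :: "'a pair_pre_digraph \<Rightarrow> ('a \<Rightarrow> 'a) set" where
  "graph_auts \<Gamma> = {f \<in> Bij (pverts \<Gamma>).
     \<forall>u\<in>pverts \<Gamma>. \<forall>v\<in>pverts \<Gamma>. (f u, f v) \<in> parcs \<Gamma> \<longleftrightarrow> (u, v) \<in> parcs \<Gamma>}"

definition graph_Aut :: "'a pair_pre_digraph \<Rightarrow> ('a \<Rightarrow> 'a) monoid" where
  "graph_Aut \<Gamma> = BijGroup (pverts \<Gamma>) \<lparr>carrier := graph_auts \<Gamma>\<rparr>"

abbreviation aut_subgroup :: "'a pair_pre_digraph \<Rightarrow> ('a \<Rightarrow> 'a) set \<Rightarrow> ('a \<Rightarrow> 'a) monoid" where
  "aut_subgroup \<Gamma> H \<equiv> graph_Aut \<Gamma> \<lparr>carrier := H\<rparr>"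

subsection \<open>Local distance transitivity\<close>

definition locally_distance_transitive ::
  "'a pair_pre_digraph \<Rightarrow> ('a \<Rightarrow> 'a) set \<Rightarrow> nat \<Rightarrow> bool" where
  "locally_distance_transitive \<Gamma> G s \<longleftrightarrow>
     subgroup G (graph_Aut \<Gamma>) \<and> s \<le> diam \<Gamma> \<and>
     (\<forall>v\<in>pverts \<Gamma>. \<forall>i\<in>{1..s}. \<forall>x\<in>sphere_at \<Gamma> i v. \<forall>y\<in>sphere_at \<Gamma> i v.
        \<exists>g\<in>stabilizer (aut_subgroup \<Gamma> G) (\<lambda>g. g) v. g x = y)"

text \<open>\<open>\<Gamma> \<in> LDT(s)\<close> relative to \<open>G\<close>. In the library, \<open>connected\<close> excludes the empty graph.\<close>

definition LDT_relative :: "nat \<Rightarrow> 'a pair_pre_digraph \<Rightarrow> ('a \<Rightarrow> 'a) set \<Rightarrow> bool" where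
  "LDT_relative s \<Gamma> G \<longleftrightarrow>
     pair_graph \<Gamma> \<and> connected (with_proj \<Gamma>) \<and>
     locally_distance_transitive \<Gamma> G (min s (diam \<Gamma>))"

subsection \<open>Normal quotients\<close>

definition normal_quotient ::
  "'a pair_pre_digraph \<Rightarrow> ('a \<Rightarrow> 'a) set \<Rightarrow> 'a set pair_pre_digraph" where
  "normal_quotient \<Gamma> N =
     (let O_N = orbits (aut_subgroup \<Gamma> N) (pverts \<Gamma>) (\<lambda>g. g) in
      \<lparr>pverts = O_N,
       parcs = {(B1, B2). B1 \<in> O_N \<and> B2 \<in> O_N \<and> B1 \<noteq> B2 \<and>
                  (\<exists>v\<in>B1. \<exists>w\<in>B2. (v, w) \<in> parcs \<Gamma>)}\<rparr>)"

text \<open>The permutation of the \<open>N\<close>-orbits induced by \<open>g\<close>.\<close>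

definition induced_perm ::
  "'a pair_pre_digraph \<Rightarrow> ('a \<Rightarrow> 'a) set \<Rightarrow> ('a \<Rightarrow> 'a) \<Rightarrow> 'a set \<Rightarrow> 'a set" where
  "induced_perm \<Gamma> N g = (\<lambda>B\<in>pverts (normal_quotient \<Gamma> N). g ` B)"

definition induced_group ::
  "'a pair_pre_digraph \<Rightarrow> ('a \<Rightarrow> 'a) set \<Rightarrow> ('a \<Rightarrow> 'a) set \<Rightarrow> ('a set \<Rightarrow> 'a set) set" where
  "induced_group \<Gamma> N G = induced_perm \<Gamma> N ` G"

definition orbit_kernel ::
  "'a pair_pre_digraph \<Rightarrow> ('a \<Rightarrow> 'a) set \<Rightarrow> ('a \<Rightarrow> 'a) set \<Rightarrow> ('a \<Rightarrow> 'a) set" where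
  "orbit_kernel \<Gamma> N G =
     kernel (aut_subgroup \<Gamma> G) (graph_Aut (normal_quotient \<Gamma> N)) (induced_perm \<Gamma> N)"

end

theory Submission
  imports Defs
begin

text \<open>
  The theorem rests on one fact about distances. An arc \<open>B \<rightarrow> C\<close> of the quotient comes from an arc
  between some representatives, and as \<open>N\<close> is transitive on \<open>B\<close> and acts by automorphisms, every
  vertex of \<open>B\<close> then has a neighbour in \<open>C\<close>. So walks of the quotient lift, with the same length,
  to walks of \<open>\<Gamma>\<close> starting at any prescribed vertex of the first orbit
  (\<open>lift_walk\<close>). Walks of \<open>\<Gamma>\<close> project to walks of the quotient that are no longer, as arcs inside
  an orbit are contracted (\<open>project_walk\<close>). Hence, for each \<open>v \<in> B\<close>, the quotient distance from
  \<open>B\<close> to \<open>C\<close> is attained as the distance from \<open>v\<close> to some vertex of \<open>C\<close>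
  (\<open>quotient_distance_attained\<close>).

  It follows that the diameter does not grow, and that the sphere condition is inherited: if \<open>C\<close>
  and \<open>D\<close> are both at distance \<open>i\<close> from \<open>B\<close>, fix \<open>v \<in> B\<close> and choose \<open>x \<in> C\<close> and \<open>y \<in> D\<close> at
  distance \<open>i\<close> from \<open>v\<close>. An element of \<open>G\<close> that fixes \<open>v\<close> and takes \<open>x\<close> to \<open>y\<close> induces a
  permutation of the orbits that fixes \<open>B\<close> and takes \<open>C\<close> to \<open>D\<close>.

  Normality of \<open>N\<close> is what makes \<open>G\<close> permute the \<open>N\<close>-orbits (\<open>image_N_orbit\<close>). This gives a
  homomorphism from \<open>G\<close> to the automorphism group of the quotient, and the identification of the
  induced group with a quotient of \<open>G\<close> is the first isomorphism theorem.
\<close>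

section \<open>Walks and distance\<close>

text \<open>
  Only the endpoints and the length of a walk matter for distances, so walks are handled as relation
  powers of the arc relation; these can be composed and split without bookkeeping of arc lists.
\<close>

lemma awalk_length_iff_relpow:
  assumes "pair_wf_digraph \<Gamma>" and "u \<in> pverts \<Gamma>"
  shows "(\<exists>p. pre_digraph.awalk (with_proj \<Gamma>) u p v \<and> length p = n) \<longleftrightarrow> (u, v) \<in> parcs \<Gamma> ^^ n"
  using assms(2)
proof (induction n arbitrary: u)
  interpret pair_wf_digraph \<Gamma> by fact
  {
    case 0
    then show ?case by (auto simp: awalk_Nil_iff)
  next
    case (Suc n)
    have "(\<exists>p. awalk u p v \<and> length p = Suc n) \<longleftrightarrow>
        (\<exists>w p. (u, w) \<in> parcs \<Gamma> \<and> awalk w p v \<and> length p = n)"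
    proof
      assume "\<exists>w p. (u, w) \<in> parcs \<Gamma> \<and> awalk w p v \<and> length p = n"
      then obtain w p where "(u, w) \<in> parcs \<Gamma>" "awalk w p v" "length p = n" by blast
      then have "awalk u ((u, w) # p) v \<and> length ((u, w) # p) = Suc n"
        by (simp add: awalk_Cons_iff)
      then show "\<exists>p. awalk u p v \<and> length p = Suc n" by blast
    qed (fastforce simp: length_Suc_conv awalk_Cons_iff)
    also have "\<dots> \<longleftrightarrow> (\<exists>w. (u, w) \<in> parcs \<Gamma> \<and> (w, v) \<in> parcs \<Gamma> ^^ n)"
      using Suc.IH[OF in_arcsD2] by blast
    also have "\<dots> \<longleftrightarrow> (u, v) \<in> parcs \<Gamma> ^^ Suc n"
      by (blast intro: relpow_Suc_I2 elim: relpow_Suc_E2)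
    finally show ?case .
  }
qed

lemma gdist_eq_relpow:
  assumes "pair_wf_digraph \<Gamma>" and "u \<in> pverts \<Gamma>"
  shows "gdist \<Gamma> u v = (LEAST n. (u, v) \<in> parcs \<Gamma> ^^ n)"
  unfolding gdist_def awalk_length_iff_relpow[OF assms] ..

lemma gdist_le:
  assumes "pair_wf_digraph \<Gamma>" and "u \<in> pverts \<Gamma>" and "(u, v) \<in> parcs \<Gamma> ^^ n"
  shows "gdist \<Gamma> u v \<le> n"
  using assms by (simp add: gdist_eq_relpow Least_le)

lemma shortest_walk:
  assumes "pair_wf_digraph \<Gamma>" and "u \<in> pverts \<Gamma>" and "(u, v) \<in> (parcs \<Gamma>)\<^sup>*"
  shows "(u, v) \<in> parcs \<Gamma> ^^ gdist \<Gamma> u v"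
  unfolding gdist_eq_relpow[OF assms(1,2)]
  by (rule LeastI_ex) (use assms(3) in \<open>simp add: rtrancl_power\<close>)

lemma connected_iff_rtrancl:
  assumes "pair_graph \<Gamma>"
  shows "connected (with_proj \<Gamma>) \<longleftrightarrow>
    pverts \<Gamma> \<noteq> {} \<and> (\<forall>u\<in>pverts \<Gamma>. \<forall>v\<in>pverts \<Gamma>. (u, v) \<in> (parcs \<Gamma>)\<^sup>*)"
proof -
  interpret pair_graph \<Gamma> by fact
  have "u \<rightarrow>\<^sup>*\<^bsub>with_proj \<Gamma>\<^esub> v" if "(u, v) \<in> (parcs \<Gamma>)\<^sup>*" "u \<in> pverts \<Gamma>" for u v
    using that awalk_length_iff_relpow[OF pair_wf_digraph that(2)]
    by (auto simp: reachable_awalk rtrancl_power)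
  moreover have "(u, v) \<in> (parcs \<Gamma>)\<^sup>*" if "u \<rightarrow>\<^sup>*\<^bsub>with_proj \<Gamma>\<^esub> v" for u v
    using reachable_rtranclI[OF that] by simp
  ultimately show ?thesis
    unfolding connected_def strongly_connected_def
    by (auto simp: reachable_mk_symmetric_eq[OF sym_arcs])
qed

section \<open>Automorphism groups acting on vertices\<close>

lemma subgroup_graph_auts: "subgroup (graph_auts \<Gamma>) (BijGroup (pverts \<Gamma>))"
proof -
  let ?V = "pverts \<Gamma>"
  interpret group "BijGroup ?V" by (rule group_BijGroup)
  show ?thesis
  proof (rule subgroupI)
    show "graph_auts \<Gamma> \<subseteq> carrier (BijGroup ?V)"
      by (auto simp: graph_auts_def BijGroup_def)
    show "graph_auts \<Gamma> \<noteq> {}"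
      using id_Bij[of ?V] by (auto simp: graph_auts_def intro!: exI[of _ "\<lambda>x\<in>?V. x"])
  next
    fix f assume f: "f \<in> graph_auts \<Gamma>"
    then have B: "f \<in> Bij ?V" by (simp add: graph_auts_def)
    then have "f ` ?V = ?V" by (simp add: Bij_def bij_betw_def)
    then have inv: "f (inv_into ?V f x) = x" "inv_into ?V f x \<in> ?V" if "x \<in> ?V" for x
      using that by (simp_all add: f_inv_into_f inv_into_into)
    have arc: "(f u, f v) \<in> parcs \<Gamma> \<longleftrightarrow> (u, v) \<in> parcs \<Gamma>" if "u \<in> ?V" "v \<in> ?V" for u v
      using f that by (simp add: graph_auts_def)
    have "(inv_into ?V f u, inv_into ?V f v) \<in> parcs \<Gamma> \<longleftrightarrow> (u, v) \<in> parcs \<Gamma>"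
      if "u \<in> ?V" "v \<in> ?V" for u v
      using arc[of "inv_into ?V f u" "inv_into ?V f v"] that by (simp add: inv)
    then show "inv\<^bsub>BijGroup ?V\<^esub> f \<in> graph_auts \<Gamma>"
      using restrict_inv_into_Bij[OF B] by (simp add: inv_BijGroup[OF B] graph_auts_def)
  next
    fix f g assume "f \<in> graph_auts \<Gamma>" "g \<in> graph_auts \<Gamma>"
    then show "f \<otimes>\<^bsub>BijGroup ?V\<^esub> g \<in> graph_auts \<Gamma>"
      using Bij_imp_funcset[of g ?V]
      by (auto simp: graph_auts_def BijGroup_def compose_Bij compose_eq Pi_iff)
  qed
qed

lemma group_graph_Aut: "group (graph_Aut \<Gamma>)"
  unfolding graph_Aut_def
  by (rule subgroup.subgroup_is_group[OF subgroup_graph_auts group_BijGroup])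

lemma graph_Aut_mult_eq_compose:
  assumes "f \<in> graph_auts \<Gamma>" "g \<in> graph_auts \<Gamma>"
  shows "f \<otimes>\<^bsub>graph_Aut \<Gamma>\<^esub> g = compose (pverts \<Gamma>) f g"
  using assms by (simp add: graph_Aut_def BijGroup_def graph_auts_def)

lemma group_action_on_vertices:
  assumes "subgroup H (graph_Aut \<Gamma>)"
  shows "group_action (aut_subgroup \<Gamma> H) (pverts \<Gamma>) (\<lambda>g. g)"
proof -
  interpret B: group "BijGroup (pverts \<Gamma>)" by (rule group_BijGroup)
  have "subgroup H (BijGroup (pverts \<Gamma>))"
    using assms B.incl_subgroup[OF subgroup_graph_auts] by (simp add: graph_Aut_def)
  then have "group_hom (BijGroup (pverts \<Gamma>) \<lparr>carrier := H\<rparr>) (BijGroup (pverts \<Gamma>)) (\<lambda>g. g)"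
    using B.canonical_inj_is_hom by (simp add: id_def)
  then show ?thesis by (simp add: group_action_def graph_Aut_def)
qed

section \<open>The induced action on the orbits of a normal subgroup\<close>

locale normal_subgroup_of_automorphisms =
  fixes \<Gamma> :: "'a pair_pre_digraph" and G N :: "('a \<Rightarrow> 'a) set"
  assumes graph: "pair_graph \<Gamma>"
    and G_subgroup: "subgroup G (graph_Aut \<Gamma>)"
    and N_normal: "N \<lhd> aut_subgroup \<Gamma> G"
begin

abbreviation "quot \<equiv> normal_quotient \<Gamma> N"

abbreviation "N_orbit \<equiv> orbit (aut_subgroup \<Gamma> N) (\<lambda>g. g)"

sublocale pair_graph \<Gamma> by (rule graph)

sublocale N: normal N "aut_subgroup \<Gamma> G" by (rule N_normal)

lemma N_subgroup: "subgroup N (graph_Aut \<Gamma>)"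
  using group.incl_subgroup[OF group_graph_Aut G_subgroup] N.subgroup_axioms by blast

sublocale G_act: group_action "aut_subgroup \<Gamma> G" "pverts \<Gamma>" "\<lambda>g. g"
  by (rule group_action_on_vertices[OF G_subgroup])

sublocale N_act: group_action "aut_subgroup \<Gamma> N" "pverts \<Gamma>" "\<lambda>g. g"
  by (rule group_action_on_vertices[OF N_subgroup])

lemma N_subset_G: "N \<subseteq> G"
  using N.subset by simp

lemma G_auts: "g \<in> G \<Longrightarrow> g \<in> graph_auts \<Gamma>"
  using subgroup.subset[OF G_subgroup] by (auto simp: graph_Aut_def)

lemma arc_image_iff:
  "g \<in> G \<Longrightarrow> u \<in> pverts \<Gamma> \<Longrightarrow> v \<in> pverts \<Gamma> \<Longrightarrow> (g u, g v) \<in> parcs \<Gamma> \<longleftrightarrow> (u, v) \<in> parcs \<Gamma>"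
  using G_auts by (simp add: graph_auts_def)

lemma G_vertex: "g \<in> G \<Longrightarrow> v \<in> pverts \<Gamma> \<Longrightarrow> g v \<in> pverts \<Gamma>"
  using G_act.element_image by simp

lemma pverts_quot: "pverts quot = N_orbit ` pverts \<Gamma>"
  by (auto simp: normal_quotient_def Let_def orbits_def)

lemma arcs_quot:
  "(B, C) \<in> parcs quot \<longleftrightarrow> B \<in> pverts quot \<and> C \<in> pverts quot \<and> B \<noteq> C \<and>
     (\<exists>v\<in>B. \<exists>w\<in>C. (v, w) \<in> parcs \<Gamma>)"
  by (simp add: normal_quotient_def Let_def)

lemma quot_vertex_subset: "B \<in> pverts quot \<Longrightarrow> B \<subseteq> pverts \<Gamma>"
  using N_act.orbits_coverture by (auto simp: normal_quotient_def Let_def)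

lemma N_orbit_self: "v \<in> pverts \<Gamma> \<Longrightarrow> v \<in> N_orbit v"
  by (rule N_act.orbit_refl)

lemma quot_vertex_eq_N_orbit:
  assumes "B \<in> pverts quot" and "v \<in> B"
  shows "B = N_orbit v"
proof -
  have v: "v \<in> pverts \<Gamma>" using assms quot_vertex_subset by blast
  then have "N_orbit v \<in> orbits (aut_subgroup \<Gamma> N) (pverts \<Gamma>) (\<lambda>g. g)"
    by (auto simp: orbits_def)
  moreover have "B \<in> orbits (aut_subgroup \<Gamma> N) (pverts \<Gamma>) (\<lambda>g. g)"
    using assms by (simp add: normal_quotient_def Let_def)
  ultimately show ?thesis
    using N_act.disjoint_union assms(2) N_orbit_self[OF v] by blast
qed

lemma quot_vertex_nonempty: "B \<in> pverts quot \<Longrightarrow> B \<noteq> {}"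
  using N_orbit_self by (auto simp: pverts_quot)

lemma same_N_orbitE:
  assumes "B \<in> pverts quot" and "v \<in> B" and "w \<in> B"
  obtains n where "n \<in> N" "n v = w"
  using assms quot_vertex_eq_N_orbit[OF assms(1,2)] by (auto simp: orbit_def)

lemma N_preserves_quot_vertex:
  assumes "B \<in> pverts quot" and "v \<in> B" and "n \<in> N"
  shows "n v \<in> B"
  using assms quot_vertex_eq_N_orbit[OF assms(1,2)] by (auto simp: orbit_def)

text \<open>Normality enters here: \<open>gN = Ng\<close> says that \<open>g\<close> takes the orbit of \<open>v\<close> to that of \<open>g v\<close>.\<close>

lemma image_N_orbit:
  assumes g: "g \<in> G" and v: "v \<in> pverts \<Gamma>"
  shows "g ` N_orbit v = N_orbit (g v)"
proof (intro equalityI subsetI)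
  let ?A = "aut_subgroup \<Gamma> G"
  have act: "(a \<otimes>\<^bsub>?A\<^esub> b) v = a (b v)" if "a \<in> G" "b \<in> G" for a b
    using G_act.composition_rule[of v a b] that v by simp
  have coset: "N #>\<^bsub>?A\<^esub> g = g <#\<^bsub>?A\<^esub> N"
    using N.coset_eq g by simp
  {
    fix x assume "x \<in> g ` N_orbit v"
    then obtain n where n: "n \<in> N" "x = g (n v)" by (auto simp: orbit_def)
    have "g \<otimes>\<^bsub>?A\<^esub> n \<in> N #>\<^bsub>?A\<^esub> g"
      unfolding coset using n(1) by (auto simp: l_coset_def)
    then obtain m where m: "m \<in> N" "g \<otimes>\<^bsub>?A\<^esub> n = m \<otimes>\<^bsub>?A\<^esub> g" by (auto simp: r_coset_def)
    have G: "n \<in> G" "m \<in> G" using n(1) m(1) N_subset_G by blast+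
    have "x = (m \<otimes>\<^bsub>?A\<^esub> g) v" by (simp only: n(2) m(2)[symmetric] act[OF g G(1)])
    also have "\<dots> = m (g v)" by (rule act[OF G(2) g])
    finally show "x \<in> N_orbit (g v)" using m(1) by (auto simp: orbit_def)
  next
    fix x assume "x \<in> N_orbit (g v)"
    then obtain n where n: "n \<in> N" "x = n (g v)" by (auto simp: orbit_def)
    have "n \<otimes>\<^bsub>?A\<^esub> g \<in> g <#\<^bsub>?A\<^esub> N"
      unfolding coset[symmetric] using n(1) by (auto simp: r_coset_def)
    then obtain m where m: "m \<in> N" "n \<otimes>\<^bsub>?A\<^esub> g = g \<otimes>\<^bsub>?A\<^esub> m" by (auto simp: l_coset_def)
    have G: "n \<in> G" "m \<in> G" using n(1) m(1) N_subset_G by blast+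
    have "x = (g \<otimes>\<^bsub>?A\<^esub> m) v" by (simp only: n(2) m(2)[symmetric] act[OF G(1) g])
    also have "\<dots> = g (m v)" by (rule act[OF g G(2)])
    finally show "x \<in> g ` N_orbit v" using m(1) by (auto simp: orbit_def)
  }
qed

lemma image_quot_vertex: "g \<in> G \<Longrightarrow> B \<in> pverts quot \<Longrightarrow> g ` B \<in> pverts quot"
  by (auto simp: pverts_quot image_N_orbit G_vertex)

lemma image_quot_vertex_eq_iff:
  assumes "g \<in> G" "B \<in> pverts quot" "C \<in> pverts quot"
  shows "g ` B = g ` C \<longleftrightarrow> B = C"
  using G_act.inj_prop[of g] assms
  by (simp add: inj_on_image_eq_iff quot_vertex_subset)

lemma induced_perm_graph_auts:
  assumes g: "g \<in> G"
  shows "induced_perm \<Gamma> N g \<in> graph_auts quot"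
proof -
  have "(\<lambda>B. g ` B) ` pverts quot = pverts quot"
  proof -
    have "(\<lambda>B. g ` B) ` pverts quot = N_orbit ` (g ` pverts \<Gamma>)"
      by (simp add: pverts_quot image_image image_N_orbit g)
    then show ?thesis
      using G_act.surj_prop[of g] g by (simp add: pverts_quot)
  qed
  then have "bij_betw (induced_perm \<Gamma> N g) (pverts quot) (pverts quot)"
    using g by (simp add: induced_perm_def bij_betw_def inj_on_def image_quot_vertex_eq_iff)
  moreover have "(g ` B, g ` C) \<in> parcs quot \<longleftrightarrow> (B, C) \<in> parcs quot"
    if "B \<in> pverts quot" "C \<in> pverts quot" for B C
  proof -
    have "(\<exists>v\<in>g ` B. \<exists>w\<in>g ` C. (v, w) \<in> parcs \<Gamma>) \<longleftrightarrow> (\<exists>v\<in>B. \<exists>w\<in>C. (v, w) \<in> parcs \<Gamma>)"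
      using that[THEN quot_vertex_subset] arc_image_iff[OF g] by (simp add: subset_iff)
    then show ?thesis
      using that g by (simp add: arcs_quot image_quot_vertex image_quot_vertex_eq_iff)
  qed
  ultimately show ?thesis
    by (simp add: graph_auts_def Bij_def induced_perm_def)
qed

lemma induced_perm_hom:
  "group_hom (aut_subgroup \<Gamma> G) (graph_Aut quot) (induced_perm \<Gamma> N)"
proof -
  have "induced_perm \<Gamma> N (g \<otimes>\<^bsub>graph_Aut \<Gamma>\<^esub> h) =
      induced_perm \<Gamma> N g \<otimes>\<^bsub>graph_Aut quot\<^esub> induced_perm \<Gamma> N h"
    if "g \<in> G" "h \<in> G" for g h
  proof -
    have "(g \<otimes>\<^bsub>graph_Aut \<Gamma>\<^esub> h) ` B = g ` h ` B" if "B \<in> pverts quot" for B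
      unfolding graph_Aut_mult_eq_compose[OF \<open>g \<in> G\<close>[THEN G_auts] \<open>h \<in> G\<close>[THEN G_auts]] image_image
      using quot_vertex_subset[OF that] by (intro image_cong) (auto simp: compose_eq)
    then show ?thesis
      using that
      unfolding graph_Aut_mult_eq_compose[OF that[THEN induced_perm_graph_auts]]
      by (simp add: induced_perm_def compose_def image_quot_vertex cong: restrict_cong)
  qed
  then show ?thesis
    using induced_perm_graph_auts N.is_group group_graph_Aut
    by (auto simp: group_hom_def group_hom_axioms_def hom_def graph_Aut_def)
qed

lemma induced_group_subgroup: "subgroup (induced_group \<Gamma> N G) (graph_Aut quot)"
  using group_hom.img_is_subgroup[OF induced_perm_hom] by (simp add: induced_group_def)

lemma orbit_kernel_normal: "orbit_kernel \<Gamma> N G \<lhd> aut_subgroup \<Gamma> G"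
  unfolding orbit_kernel_def by (rule group_hom.normal_kernel[OF induced_perm_hom])

lemma Mod_orbit_kernel_iso:
  "(aut_subgroup \<Gamma> G) Mod (orbit_kernel \<Gamma> N G) \<cong> aut_subgroup quot (induced_group \<Gamma> N G)"
proof -
  interpret hom: group_hom "aut_subgroup \<Gamma> G" "graph_Aut quot" "induced_perm \<Gamma> N"
    by (rule induced_perm_hom)
  let ?I = "aut_subgroup quot (induced_group \<Gamma> N G)"
  have "group ?I"
    by (rule subgroup.subgroup_is_group[OF induced_group_subgroup group_graph_Aut])
  then have onto: "group_hom (aut_subgroup \<Gamma> G) ?I (induced_perm \<Gamma> N)"
    using hom.homh N.is_group
    by (auto simp: group_hom_def group_hom_axioms_def hom_def induced_group_def)
  \<comment> \<open>The isomorphism theorem wants a surjective map. Shrinking the codomain to the image keeps the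
    unit element, hence also the kernel.\<close>
  have "orbit_kernel \<Gamma> N G = kernel (aut_subgroup \<Gamma> G) ?I (induced_perm \<Gamma> N)"
    by (simp add: orbit_kernel_def kernel_def)
  then show ?thesis
    using group_hom.FactGroup_iso[OF onto] by (simp add: induced_group_def)
qed

section \<open>Distances in the normal quotient\<close>

lemma pair_graph_quot: "pair_graph quot"
proof
  have fin: "finite (pverts quot)" using pair_finite_verts by (simp add: pverts_quot)
  then show "finite (pverts quot)" .
  have "parcs quot \<subseteq> pverts quot \<times> pverts quot" by (auto simp: arcs_quot)
  then show "finite (parcs quot)" using fin finite_subset by blast
  show "symmetric (with_proj quot)"
    using arcs_symmetric by (auto simp: symmetric_def sym_def arcs_quot)
qed (auto simp: arcs_quot)

lemma pair_wf_digraph_quot: "pair_wf_digraph quot"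
  using pair_graph_quot by (simp add: pair_graph_def pair_digraph_def pair_fin_digraph_def)

text \<open>Translating by an element of \<open>N\<close> moves the tail of an arc to any vertex of its orbit.\<close>

lemma lift_arc:
  assumes "(B, C) \<in> parcs quot" and "v \<in> B"
  obtains w where "w \<in> C" "(v, w) \<in> parcs \<Gamma>"
proof -
  have BC: "B \<in> pverts quot" "C \<in> pverts quot" using assms by (simp_all add: arcs_quot)
  obtain b c where bc: "b \<in> B" "c \<in> C" "(b, c) \<in> parcs \<Gamma>" using assms by (auto simp: arcs_quot)
  obtain n where n: "n \<in> N" "n b = v" using same_N_orbitE[OF BC(1) bc(1) assms(2)] .
  show thesis
  proof
    show "n c \<in> C" using N_preserves_quot_vertex[OF BC(2) bc(2) n(1)] .
    show "(v, n c) \<in> parcs \<Gamma>"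
      using arc_image_iff[of n b c] bc(3) n N_subset_G in_arcsD1 in_arcsD2 by blast
  qed
qed

lemma lift_walk:
  assumes "(B, C) \<in> parcs quot ^^ k" and "v \<in> B"
  shows "\<exists>w\<in>C. (v, w) \<in> parcs \<Gamma> ^^ k"
  using assms
proof (induction k arbitrary: C)
  case (Suc k)
  from Suc.prems(1) obtain D where D: "(B, D) \<in> parcs quot ^^ k" "(D, C) \<in> parcs quot" by auto
  then obtain u where "u \<in> D" "(v, u) \<in> parcs \<Gamma> ^^ k" using Suc.IH Suc.prems(2) by blast
  then show ?case using lift_arc[OF D(2)] by (metis relpow_Suc_I)
qed auto

lemma project_walk:
  assumes "(v, w) \<in> parcs \<Gamma> ^^ k" and "v \<in> pverts \<Gamma>"
  shows "\<exists>j\<le>k. (N_orbit v, N_orbit w) \<in> parcs quot ^^ j"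
  using assms
proof (induction k arbitrary: w)
  case (Suc k)
  then obtain u where u: "(v, u) \<in> parcs \<Gamma> ^^ k" "(u, w) \<in> parcs \<Gamma>" by auto
  with Suc obtain j where j: "j \<le> k" "(N_orbit v, N_orbit u) \<in> parcs quot ^^ j" by blast
  show ?case
  proof (cases "N_orbit u = N_orbit w")
    case True
    then show ?thesis using j le_SucI by metis
  next
    case False
    then have "(N_orbit u, N_orbit w) \<in> parcs quot"
      using u(2) in_arcsD1[OF u(2)] in_arcsD2[OF u(2)] N_orbit_self
      unfolding arcs_quot pverts_quot by blast
    then show ?thesis using j by (metis Suc_le_mono relpow_Suc_I)
  qed
qed auto

lemma connected_quot:
  assumes "connected (with_proj \<Gamma>)"
  shows "connected (with_proj quot)"
proof -
  have "(N_orbit u, N_orbit v) \<in> (parcs quot)\<^sup>*" if "u \<in> pverts \<Gamma>" "v \<in> pverts \<Gamma>" for u v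
    using assms that project_walk[of u v] relpow_imp_rtrancl
    unfolding connected_iff_rtrancl[OF graph] by (metis rtrancl_power)
  then show ?thesis
    using assms unfolding connected_iff_rtrancl[OF graph] connected_iff_rtrancl[OF pair_graph_quot]
    by (auto simp: pverts_quot)
qed

text \<open>
  Lifting a shortest walk of the quotient bounds the distance in \<open>\<Gamma>\<close> from above, and projecting a
  shortest walk of \<open>\<Gamma>\<close> bounds it from below.
\<close>

lemma quotient_distance_attained:
  assumes conn: "connected (with_proj \<Gamma>)"
    and B: "B \<in> pverts quot" and C: "C \<in> pverts quot" and v: "v \<in> B"
  obtains w where "w \<in> C" "gdist \<Gamma> v w = gdist quot B C"
proof -
  have vV: "v \<in> pverts \<Gamma>" using B v quot_vertex_subset by blast
  have "(B, C) \<in> parcs quot ^^ gdist quot B C"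
    using shortest_walk[OF pair_wf_digraph_quot B] connected_quot[OF conn] B C
    unfolding connected_iff_rtrancl[OF pair_graph_quot] by blast
  then obtain w where w: "w \<in> C" "(v, w) \<in> parcs \<Gamma> ^^ gdist quot B C"
    using lift_walk v by blast
  have "(v, w) \<in> parcs \<Gamma> ^^ gdist \<Gamma> v w"
    using shortest_walk[OF pair_wf_digraph vV] w(2) relpow_imp_rtrancl by blast
  then obtain j where j: "j \<le> gdist \<Gamma> v w" "(N_orbit v, N_orbit w) \<in> parcs quot ^^ j"
    using project_walk vV by blast
  have "gdist quot B C \<le> gdist \<Gamma> v w"
    using gdist_le[OF pair_wf_digraph_quot B] j
      quot_vertex_eq_N_orbit[OF B v] quot_vertex_eq_N_orbit[OF C w(1)] le_trans by metis
  moreover have "gdist \<Gamma> v w \<le> gdist quot B C"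
    by (rule gdist_le[OF pair_wf_digraph vV w(2)])
  ultimately show thesis using that w(1) by simp
qed

lemma diam_quot_le:
  assumes "connected (with_proj \<Gamma>)"
  shows "diam quot \<le> diam \<Gamma>"
proof -
  let ?D = "\<lambda>\<Delta>. {gdist \<Delta> u v | u v. u \<in> pverts \<Delta> \<and> v \<in> pverts \<Delta>}"
  have "?D \<Gamma> = (\<lambda>(u, v). gdist \<Gamma> u v) ` (pverts \<Gamma> \<times> pverts \<Gamma>)" by auto
  then have "finite (?D \<Gamma>)" using pair_finite_verts by simp
  moreover have "pverts quot \<noteq> {}"
    using assms by (simp add: connected_iff_rtrancl[OF graph] pverts_quot)
  then have "?D quot \<noteq> {}" by auto
  moreover have "?D quot \<subseteq> ?D \<Gamma>"
  proof
    fix d assume "d \<in> ?D quot"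
    then obtain B C where BC: "B \<in> pverts quot" "C \<in> pverts quot" and d: "d = gdist quot B C"
      by blast
    obtain v where v: "v \<in> B" using quot_vertex_nonempty[OF BC(1)] by blast
    obtain w where "w \<in> C" "gdist \<Gamma> v w = d"
      using quotient_distance_attained[OF assms BC v] d by metis
    then show "d \<in> ?D \<Gamma>" using v BC quot_vertex_subset by blast
  qed
  ultimately show ?thesis unfolding diam_def by (intro Max_mono)
qed

section \<open>Inheritance of local distance transitivity\<close>

lemma sphere_transitive_quot:
  assumes conn: "connected (with_proj \<Gamma>)"
    and trans: "\<And>v x y. \<lbrakk>v \<in> pverts \<Gamma>; x \<in> sphere_at \<Gamma> i v; y \<in> sphere_at \<Gamma> i v\<rbrakk>
      \<Longrightarrow> \<exists>g\<in>stabilizer (aut_subgroup \<Gamma> G) (\<lambda>g. g) v. g x = y"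
    and B: "B \<in> pverts quot" and CD: "C \<in> sphere_at quot i B" "D \<in> sphere_at quot i B"
  shows "\<exists>h\<in>stabilizer (aut_subgroup quot (induced_group \<Gamma> N G)) (\<lambda>h. h) B. h C = D"
proof -
  have C: "C \<in> pverts quot" "gdist quot B C = i" and D: "D \<in> pverts quot" "gdist quot B D = i"
    using CD by (simp_all add: sphere_at_def)
  obtain v where v: "v \<in> B" using quot_vertex_nonempty[OF B] by blast
  obtain x where x: "x \<in> C" "gdist \<Gamma> v x = i"
    using quotient_distance_attained[OF conn B C(1) v] C(2) by metis
  obtain y where y: "y \<in> D" "gdist \<Gamma> v y = i"
    using quotient_distance_attained[OF conn B D(1) v] D(2) by metis
  have V: "v \<in> pverts \<Gamma>" "x \<in> pverts \<Gamma>" "y \<in> pverts \<Gamma>"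
    using B C(1) D(1) v x(1) y(1) quot_vertex_subset by blast+
  obtain g where g: "g \<in> G" "g v = v" "g x = y"
    using trans[OF V(1), of x y] V x y by (auto simp: sphere_at_def stabilizer_def)
  have "g ` B = B" "g ` C = D"
    using image_N_orbit[OF g(1)] V g(2,3) quot_vertex_eq_N_orbit[OF B v]
      quot_vertex_eq_N_orbit[OF C(1) x(1)] quot_vertex_eq_N_orbit[OF D(1) y(1)] by simp_all
  then have "induced_perm \<Gamma> N g B = B" "induced_perm \<Gamma> N g C = D"
    using B C(1) by (simp_all add: induced_perm_def)
  then show ?thesis using g(1) by (auto simp: stabilizer_def induced_group_def)
qed

lemma LDT_relative_quot:
  assumes "LDT_relative s \<Gamma> G"
  shows "LDT_relative s quot (induced_group \<Gamma> N G)"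
proof -
  have conn: "connected (with_proj \<Gamma>)"
    and ldt: "locally_distance_transitive \<Gamma> G (min s (diam \<Gamma>))"
    using assms by (simp_all add: LDT_relative_def)
  have "\<exists>h\<in>stabilizer (aut_subgroup quot (induced_group \<Gamma> N G)) (\<lambda>h. h) B. h C = D"
    if i: "i \<in> {1..min s (diam quot)}" and B: "B \<in> pverts quot"
      and CD: "C \<in> sphere_at quot i B" "D \<in> sphere_at quot i B" for i B C D
  proof (rule sphere_transitive_quot[OF conn _ B CD])
    fix v x y
    assume "v \<in> pverts \<Gamma>" "x \<in> sphere_at \<Gamma> i v" "y \<in> sphere_at \<Gamma> i v"
    moreover have "i \<in> {1..min s (diam \<Gamma>)}" using i diam_quot_le[OF conn] by auto
    ultimately show "\<exists>g\<in>stabilizer (aut_subgroup \<Gamma> G) (\<lambda>g. g) v. g x = y"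
      using ldt unfolding locally_distance_transitive_def by blast
  qed
  then show ?thesis
    using pair_graph_quot connected_quot[OF conn] induced_group_subgroup
    unfolding LDT_relative_def locally_distance_transitive_def by simp
qed

end

section \<open>Normal quotients of locally distance transitive graphs\<close>

theorem theorem1p1:
  fixes s :: nat
    and \<Gamma> :: "'a pair_pre_digraph"
    and G N :: "('a \<Rightarrow> 'a) set"
  assumes "s \<ge> 1"
    and "LDT_relative s \<Gamma> G"
    and "N \<lhd> aut_subgroup \<Gamma> G"
  shows "orbit_kernel \<Gamma> N G \<lhd> aut_subgroup \<Gamma> G \<and>
         (aut_subgroup \<Gamma> G) Mod (orbit_kernel \<Gamma> N G)
           \<cong> aut_subgroup (normal_quotient \<Gamma> N) (induced_group \<Gamma> N G) \<and>
         LDT_relative s (normal_quotient \<Gamma> N) (induced_group \<Gamma> N G)"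
proof -
  interpret normal_subgroup_of_automorphisms \<Gamma> G N
    using assms
    by (simp add: normal_subgroup_of_automorphisms_def LDT_relative_def
        locally_distance_transitive_def)
  show ?thesis
    using orbit_kernel_normal Mod_orbit_kernel_iso LDT_relative_quot[OF assms(2)] by blast
qed

end
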